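(* Let $L$ be a regular language whose minimal DFA has $d$ states. Then any $n$-dimensional MO-1gQFA recognizing $L$ with cut-point isolated by $\delta$ must satisfy $$n\geq\left[\frac{\log d}{2\log\frac{2}{\delta}}\right]^{\frac{4}{9}}.$$
   Context: A trace-preserving quantum operation on a finite-dimensional complex Hilbert space $\mathcal{H}$ is a linear map $\mathcal{E}$ on the linear operators on $\mathcal{H}$ of the form $\mathcal{E}(\rho)=\sum_k E_k\rho E_k^\dagger$ with $\sum_k E_k^\dagger E_k=I$. A density operator is a positive semi-definite operator of trace $1$. An $n$-dimensional MO-1gQFA is a tuple $\mathcal{A}=(\mathcal{H},\Sigma,\rho_0,\{\mathcal{E}_\sigma\}_{\sigma\in\Sigma},P_{acc})$, where $\mathcal{H}$ is a complex Hilbert space of finite dimension $n$, $\Sigma$ is a finite alphabet, $\rho_0$ is a density operator on $\mathcal{H}$, each $\mathcal{E}_\sigma$ is a trace-preserving quantum operation on $\mathcal{H}$, and $P_{acc}$ is an (orthogonal) projector on a subspace of $\mathcal{H}$. It accepts $x=x_1x_2\cdots x_m\in\Sigma^*$ with probability $$\mathcal{P}_{\mathcal{A}}(x)=\mathrm{Tr}\big(P_{acc}\,\mathcal{E}_{x_m}\circ\cdots\circ\mathcal{E}_{x_2}\circ\mathcal{E}_{x_1}(\rho_0)\big).$$ A language $L\subseteq\Sigma^*$ is recognized by $\mathcal{A}$ with cut-point isolated by $\delta$, where $\delta\in(0,\frac12]$, if there is $\lambda\in(0,1]$ such that $\mathcal{P}_{\mathcal{A}}(x)>\lambda$ for all $x\in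 L$, $\mathcal{P}_{\mathcal{A}}(x)\le\lambda$ for all $x\notin L$, and $|\mathcal{P}_{\mathcal{A}}(x)-\lambda|\ge\delta$ for all $x\in\Sigma^*$. A DFA is a deterministic finite automaton with a total transition function. *)

theory Defs
  imports "HOL-Analysis.Analysis"
begin

text \<open>
  An \<open>n\<close>-dimensional complex Hilbert space is \<^typ>\<open>complex ^ 'n\<close> with the standard Hermitian
  inner product and \<open>n = CARD('n)\<close>; linear operators on it are given by their matrices.
\<close>

type_synonym 'n cop = "((complex, 'n) vec, 'n) vec"

definition cinner :: "complex ^ 'n \<Rightarrow> complex ^ 'n \<Rightarrow> complex" where
  "cinner u v = (\<Sum>i\<in>UNIV. cnj (u $ i) * v $ i)"

definition adjoint_mat :: "'n::finite cop \<Rightarrow> 'n cop" where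
  "adjoint_mat A = (\<chi> i j. cnj (A $ j $ i))"

definition psd :: "'n::finite cop \<Rightarrow> bool" where
  "psd A \<longleftrightarrow> adjoint_mat A = A \<and> (\<forall>v. 0 \<le> Re (cinner v (A *v v)))"

definition density_operator :: "'n::finite cop \<Rightarrow> bool" where
  "density_operator \<rho> \<longleftrightarrow> psd \<rho> \<and> trace \<rho> = 1"

definition orth_projector :: "'n::finite cop \<Rightarrow> bool" where
  "orth_projector P \<longleftrightarrow> P ** P = P \<and> adjoint_mat P = P"

definition tp_quantum_operation :: "('n::finite cop \<Rightarrow> 'n cop) \<Rightarrow> bool" where
  "tp_quantum_operation \<E> \<longleftrightarrow>
     (\<exists>(m::nat) E. (\<Sum>k<m. adjoint_mat (E k) ** E k) = mat 1 \<and>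
        (\<forall>\<rho>. \<E> \<rho> = (\<Sum>k<m. E k ** \<rho> ** adjoint_mat (E k))))"

record ('a, 'n::finite) mo1gqfa =
  q_init :: "'n cop"
  q_op :: "'a \<Rightarrow> 'n cop \<Rightarrow> 'n cop"
  q_acc :: "'n cop"

definition mo1gqfa :: "'a set \<Rightarrow> ('a, 'n::finite) mo1gqfa \<Rightarrow> bool" where
  "mo1gqfa \<Sigma> A \<longleftrightarrow> finite \<Sigma> \<and> density_operator (q_init A) \<and>
     (\<forall>\<sigma>\<in>\<Sigma>. tp_quantum_operation (q_op A \<sigma>)) \<and> orth_projector (q_acc A)"

text \<open>
  \<^term>\<open>fold\<close> applies the operation of the first letter first. For an automaton satisfying
  \<^const>\<open>mo1gqfa\<close> and a word over its alphabet the trace is a real number, so \<^const>\<open>Re\<close> only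
  changes the type.
\<close>
definition acc_prob :: "('a, 'n::finite) mo1gqfa \<Rightarrow> 'a list \<Rightarrow> real" where
  "acc_prob A x = Re (trace (q_acc A ** fold (q_op A) x (q_init A)))"

definition recognizes_isolated ::
    "'a set \<Rightarrow> ('a, 'n::finite) mo1gqfa \<Rightarrow> 'a list set \<Rightarrow> real \<Rightarrow> bool" where
  "recognizes_isolated \<Sigma> A L \<delta> \<longleftrightarrow>
     (\<exists>cp. 0 < cp \<and> cp \<le> 1 \<and>
        (\<forall>x\<in>L. acc_prob A x > cp) \<and>
        (\<forall>x\<in>lists \<Sigma> - L. acc_prob A x \<le> cp) \<and>
        (\<forall>x\<in>lists \<Sigma>. \<bar>acc_prob A x - cp\<bar> \<ge> \<delta>))"

record ('a, 'q) dfa =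
  d_states :: "'q set"
  d_init :: 'q
  d_trans :: "'a \<Rightarrow> 'q \<Rightarrow> 'q"
  d_final :: "'q set"

definition dfa :: "'a set \<Rightarrow> ('a, 'q) dfa \<Rightarrow> bool" where
  "dfa \<Sigma> M \<longleftrightarrow> finite \<Sigma> \<and> finite (d_states M) \<and> d_init M \<in> d_states M \<and>
     (\<forall>a\<in>\<Sigma>. \<forall>q\<in>d_states M. d_trans M a q \<in> d_states M) \<and> d_final M \<subseteq> d_states M"

definition dfa_lang :: "'a set \<Rightarrow> ('a, 'q) dfa \<Rightarrow> 'a list set" where
  "dfa_lang \<Sigma> M = {x \<in> lists \<Sigma>. fold (d_trans M) x (d_init M) \<in> d_final M}"

text \<open>
  The competing automata have natural numbers as states, which is no restriction because every
  DFA has finitely many states and can be renamed. Since a minimal DFA exists exactly for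
  regular languages, \<open>minimal_dfa \<Sigma> M L\<close> entails that \<open>L\<close> is regular.
\<close>
definition minimal_dfa :: "'a set \<Rightarrow> ('a, 'q) dfa \<Rightarrow> 'a list set \<Rightarrow> bool" where
  "minimal_dfa \<Sigma> M L \<longleftrightarrow> dfa \<Sigma> M \<and> dfa_lang \<Sigma> M = L \<and>
     (\<forall>M' :: ('a, nat) dfa. dfa \<Sigma> M' \<and> dfa_lang \<Sigma> M' = L \<longrightarrow>
        card (d_states M) \<le> card (d_states M'))"

end

theory Submission imports Defs begin

text \<open>
  Every word \<open>x\<close> leads the quantum automaton to a density operator \<open>\<rho>\<^sub>x\<close>, and every word \<open>z\<close> gives
  the real-linear functional \<open>f\<^sub>z(X) = Re Tr(P \<E>\<^sub>z(X))\<close> on the space of complex matrices, with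
  \<open>f\<^sub>z(\<rho>\<^sub>x) = P(xz) \<in> [0,1]\<close>. Words \<open>x\<close>, \<open>y\<close> with different residual languages are told apart by
  some \<open>z\<close>, and then \<open>|f\<^sub>z(\<rho>\<^sub>x) - f\<^sub>z(\<rho>\<^sub>y)| \<ge> 2\<delta>\<close>. A volume argument in the \<open>2n\<^sup>2\<close>-dimensional real space of
  matrices bounds the number of such points by \<open>(1 + 1/\<delta>)\<close> to the power \<open>2n\<^sup>2\<close>, which is at most
  \<open>(2/\<delta>)\<close> to the power \<open>2n\<^sup>2\<close>. The residual languages are the states of a DFA for \<open>L\<close>, so \<open>d\<close> obeys the
  same bound; this gives even the exponent \<open>1/2\<close> instead of \<open>4/9\<close>.
\<close>

section \<open>Packing with respect to linear functionals\<close>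

text \<open>Around each point lies a copy of the symmetric body \<open>C \<delta>\<close>.
  Separation by \<open>2 * \<delta>\<close> makes the copies disjoint, the bound 1 puts them all
  into \<open>C (1 + \<delta>)\<close>, and volume scales with the power \<open>DIM('v)\<close> of
  the dilation factor.\<close>

lemma card_separated_by_functionals_le:
  fixes p :: "'i \<Rightarrow> 'v::euclidean_space" and F :: "('v \<Rightarrow> real) set"
  assumes I: "finite I" and \<delta>: "0 < \<delta>"
    and lin: "\<And>f. f \<in> F \<Longrightarrow> linear f"
    and bnd: "\<And>f i. f \<in> F \<Longrightarrow> i \<in> I \<Longrightarrow> \<bar>f (p i)\<bar> \<le> 1"
    and sep: "\<And>i j. i \<in> I \<Longrightarrow> j \<in> I \<Longrightarrow> i \<noteq> j \<Longrightarrow> \<exists>f\<in>F. \<bar>f (p i) - f (p j)\<bar> \<ge> 2 * \<delta>"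
  shows "real (card I) \<le> (1 + 1 / \<delta>) ^ DIM('v)"
proof -
  obtain g where g: "\<And>i j. i \<in> I \<Longrightarrow> j \<in> I \<Longrightarrow> i \<noteq> j \<Longrightarrow>
      g i j \<in> F \<and> \<bar>g i j (p i) - g i j (p j)\<bar> \<ge> 2 * \<delta>"
    using sep by metis
  \<comment> \<open>One chosen separating functional per pair leaves finitely many, so that the
    intersection of strips in \<open>C\<close> is open.\<close>
  define G where "G = {g i j | i j. i \<in> I \<and> j \<in> I \<and> i \<noteq> j}"
  have "G \<subseteq> (\<lambda>(i, j). g i j) ` (I \<times> I)"
    by (auto simp: G_def)
  then have finG: "finite G"
    using I finite_subset by blast
  have GF: "G \<subseteq> F"
    using g by (auto simp: G_def)
  \<comment> \<open>\<open>K\<close> plays for the norm the role that 1 plays for the functionals;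
    the summand 1 keeps it positive when all points are 0.\<close>
  obtain K where K: "0 < K" "\<And>i. i \<in> I \<Longrightarrow> norm (p i) \<le> K"
  proof
    show "0 < 1 + (\<Sum>i\<in>I. norm (p i))"
      by (simp add: add_pos_nonneg sum_nonneg)
    show "norm (p i) \<le> 1 + (\<Sum>i\<in>I. norm (p i))" if "i \<in> I" for i
      using member_le_sum[of i I "\<lambda>i. norm (p i)"] that I by simp
  qed
  \<comment> \<open>The bound on the norm makes \<open>C r\<close> bounded even if the functionals have a common kernel.\<close>
  define C where "C r = {v. norm v < K * r} \<inter> (\<Inter>f\<in>G. {v. \<bar>f v\<bar> < r})" for r
  have openC: "open (C r)" for r
  proof -
    have "open {v. \<bar>f v\<bar> < r}" if "f \<in> G" for f
      using lin that GF
      by (intro open_Collect_less continuous_intros linear_continuous_on linear_conv_bounded_linear[THEN iffD1]) auto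
    then show ?thesis
      unfolding C_def by (intro open_Int open_INT finG open_Collect_less continuous_intros) auto
  qed
  have bddC: "bounded (C r)" for r
    by (rule bounded_subset[of "ball 0 (K * r)"]) (auto simp: C_def)
  have measC: "C r \<in> lmeasurable" for r
    using lmeasurable_open openC bddC by blast
  \<comment> \<open>The summand 0 gives the dilation the affine shape of
    \<open>measure_lebesgue_affine\<close>.\<close>
  have scale: "C r = (\<lambda>v. r *\<^sub>R v + 0) ` C 1" if "0 < r" for r
  proof (intro set_eqI iffI)
    fix v assume v: "v \<in> C r"
    have "\<bar>f (v /\<^sub>R r)\<bar> < 1" if "f \<in> G" for f
      using v that lin GF \<open>0 < r\<close>
      by (auto simp: C_def linear_scale subset_iff abs_mult field_simps)
    moreover have "norm (v /\<^sub>R r) < K"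
      using v \<open>0 < r\<close> by (simp add: C_def field_simps)
    ultimately show "v \<in> (\<lambda>v. r *\<^sub>R v + 0) ` C 1"
      using \<open>0 < r\<close> by (intro image_eqI[of _ _ "v /\<^sub>R r"]) (auto simp: C_def)
  next
    fix v assume "v \<in> (\<lambda>v. r *\<^sub>R v + 0) ` C 1"
    then show "v \<in> C r"
      using lin GF \<open>0 < r\<close>
      by (auto simp: C_def linear_scale subset_iff abs_mult field_simps)
  qed
  have vol: "measure lebesgue (C r) = r ^ DIM('v) * measure lebesgue (C 1)" if "0 < r" for r
    using measure_lebesgue_affine[of r 0 "C 1"] that by (simp add: scale[OF that])
  \<comment> \<open>A nonempty open set has positive measure, so this volume can be cancelled at the
    end.\<close>
  have "0 \<in> C 1"
    using K(1) lin GF by (auto simp: C_def linear_0 subset_iff)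
  then have pos: "0 < measure lebesgue (C 1)"
    using open_not_negligible[OF openC, of 1] measC[of 1]
    by (auto simp: negligible_iff_measure zero_less_measure_iff)
  have sub: "(+) (p i) ` C \<delta> \<subseteq> C (1 + \<delta>)" if "i \<in> I" for i
  proof
    fix w assume "w \<in> (+) (p i) ` C \<delta>"
    then obtain v where v: "v \<in> C \<delta>" "w = p i + v"
      by blast
    have "norm w < K * (1 + \<delta>)"
      using norm_triangle_ineq[of "p i" v] K(2)[OF that] v by (simp add: C_def distrib_left)
    moreover have "\<bar>f w\<bar> < 1 + \<delta>" if f: "f \<in> G" for f
    proof -
      have "\<bar>f (p i)\<bar> \<le> 1" "\<bar>f v\<bar> < \<delta>"
        using f GF bnd \<open>i \<in> I\<close> v by (auto simp: C_def)
      moreover have "f w = f (p i) + f v"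
        using f GF lin v by (auto simp: linear_add subset_iff)
      ultimately show ?thesis
        by linarith
    qed
    ultimately show "w \<in> C (1 + \<delta>)"
      by (simp add: C_def)
  qed
  have disj: "disjoint_family_on (\<lambda>i. (+) (p i) ` C \<delta>) I"
    unfolding disjoint_family_on_def
  proof (intro ballI impI, rule ccontr)
    fix i j assume ij: "i \<in> I" "j \<in> I" "i \<noteq> j" and "(+) (p i) ` C \<delta> \<inter> (+) (p j) ` C \<delta> \<noteq> {}"
    then obtain u v where uv: "u \<in> C \<delta>" "v \<in> C \<delta>" "p i + u = p j + v"
      by blast
    have f: "g i j \<in> G" "linear (g i j)"
      using ij g lin by (auto simp: G_def)
    \<comment> \<open>At a common point the gap between the centres equals
      \<open>g i j v - g i j u\<close>, which is strictly below \<open>2 * \<delta>\<close> in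
      absolute value.\<close>
    have "g i j (p i) + g i j u = g i j (p j) + g i j v"
      using f(2) uv(3) by (metis linear_add)
    moreover have "\<bar>g i j u\<bar> < \<delta>" "\<bar>g i j v\<bar> < \<delta>"
      using uv f by (auto simp: C_def)
    moreover have "\<bar>g i j (p i) - g i j (p j)\<bar> \<ge> 2 * \<delta>"
      using g ij by blast
    ultimately show False
      by linarith
  qed
  have "card I * (\<delta> ^ DIM('v) * measure lebesgue (C 1)) = (\<Sum>i\<in>I. measure lebesgue ((+) (p i) ` C \<delta>))"
    by (simp add: measure_translation vol[OF \<delta>])
  also have "\<dots> = measure lebesgue (\<Union>i\<in>I. (+) (p i) ` C \<delta>)"
    using I disj measurable_translation[OF measC]
    by (intro measure_finite_Union[symmetric]) (auto simp del: emeasure_completion dest: fmeasurableD2)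
  also have "\<dots> \<le> measure lebesgue (C (1 + \<delta>))"
    using sub I measurable_translation[OF measC] measC
    by (intro measure_mono_fmeasurable UN_least sets.finite_UN fmeasurableD) auto
  also have "\<dots> = (1 + \<delta>) ^ DIM('v) * measure lebesgue (C 1)"
    using \<delta> by (intro vol) simp
  finally have "card I * \<delta> ^ DIM('v) \<le> (1 + \<delta>) ^ DIM('v)"
    using pos by (simp add: mult.assoc[symmetric])
  moreover have "1 + 1 / \<delta> = (1 + \<delta>) / \<delta>"
    using \<delta> by (simp add: field_simps)
  ultimately show ?thesis
    using \<delta> by (simp add: power_divide pos_le_divide_eq)
qed

section \<open>Quantum operations\<close>

lemma linear_matrix_sandwich: "linear (\<lambda>X. A ** X ** B :: complex ^ 'n ^ 'n)"
  by (rule linearI)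
    (simp_all add: vec_eq_iff matrix_matrix_mult_def sum.distrib scaleR_sum_right
       distrib_left distrib_right sum_distrib_right)

lemma linear_trace: "linear (trace :: 'n::finite cop \<Rightarrow> complex)"
  by (rule linearI) (simp_all add: trace_def sum.distrib scaleR_sum_right)

lemma linear_adjoint_mat: "linear (adjoint_mat :: 'n::finite cop \<Rightarrow> 'n cop)"
  by (rule linearI) (simp_all add: adjoint_mat_def vec_eq_iff)

lemma adjoint_mat_idem [simp]: "adjoint_mat (adjoint_mat A) = A"
  by (simp add: adjoint_mat_def vec_eq_iff)

lemma adjoint_mat_mult: "adjoint_mat (A ** B) = adjoint_mat B ** adjoint_mat A"
  by (simp add: adjoint_mat_def vec_eq_iff matrix_matrix_mult_def mult.commute)

lemma adjoint_mat_one [simp]: "adjoint_mat (mat 1) = mat 1"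
  by (simp add: adjoint_mat_def vec_eq_iff mat_def)

lemma cinner_matrix_vector: "cinner v (A *v w) = cinner (adjoint_mat A *v v) w"
proof -
  have "cinner v (A *v w) = (\<Sum>i\<in>UNIV. \<Sum>j\<in>UNIV. cnj (v $ i) * A $ i $ j * w $ j)"
    by (simp add: cinner_def matrix_vector_mult_def sum_distrib_left mult.assoc)
  also have "\<dots> = (\<Sum>j\<in>UNIV. \<Sum>i\<in>UNIV. cnj (v $ i) * A $ i $ j * w $ j)"
    by (rule sum.swap)
  also have "\<dots> = cinner (adjoint_mat A *v v) w"
    by (simp add: cinner_def matrix_vector_mult_def adjoint_mat_def sum_distrib_left mult_ac)
  finally show ?thesis .
qed

lemma psd_conjugate:
  assumes "psd \<rho>"
  shows "psd (E ** \<rho> ** adjoint_mat E)"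
proof -
  have "cinner v (E ** \<rho> ** adjoint_mat E *v v) = cinner (adjoint_mat E *v v) (\<rho> *v (adjoint_mat E *v v))" for v
    unfolding matrix_vector_mul_assoc[symmetric] by (rule cinner_matrix_vector)
  moreover have "adjoint_mat (E ** \<rho> ** adjoint_mat E) = E ** \<rho> ** adjoint_mat E"
    using assms by (simp add: psd_def adjoint_mat_mult matrix_mul_assoc)
  ultimately show ?thesis
    using assms by (simp add: psd_def)
qed

lemma psd_sum:
  fixes f :: "'k \<Rightarrow> 'n::finite cop"
  assumes "\<And>k. k \<in> K \<Longrightarrow> psd (f k)"
  shows "psd (\<Sum>k\<in>K. f k)"
proof -
  have "psd (0 :: 'n cop)"
    by (simp add: psd_def linear_0[OF linear_adjoint_mat] cinner_def)
  moreover have "psd (X + Y)" if "psd X" "psd Y" for X Y :: "'n cop"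
    using that
    by (simp add: psd_def linear_0[OF linear_adjoint_mat] linear_add[OF linear_adjoint_mat] cinner_def
        matrix_vector_mult_add_rdistrib distrib_left sum.distrib)
  ultimately show ?thesis
    using assms by (induction K rule: infinite_finite_induct) auto
qed

text \<open>Diagonal entries are values of the quadratic form at the standard basis vectors.\<close>

lemma trace_psd_nonneg:
  assumes "psd \<rho>"
  shows "0 \<le> Re (trace \<rho>)"
proof -
  have "cinner (axis i 1) (\<rho> *v axis i 1) = \<rho> $ i $ i" for i
    by (simp add: cinner_def axis_def matrix_vector_mult_def if_distrib[of cnj]
        mult_delta_left mult_delta_right cong: if_cong)
  then have "0 \<le> Re (\<rho> $ i $ i)" for i
    using assms unfolding psd_def by metis
  then show ?thesis
    by (simp add: trace_def sum_nonneg)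
qed

text \<open>Idempotence and cyclicity of the trace turn the product into the conjugate of
  \<open>\<rho>\<close> by \<open>P\<close>, which is again positive.\<close>

lemma trace_projector_psd_nonneg:
  assumes "orth_projector P" "psd \<rho>"
  shows "0 \<le> Re (trace (P ** \<rho>))"
proof -
  have "trace (P ** \<rho>) = trace (P ** (P ** \<rho>))"
    using assms(1) by (simp add: orth_projector_def matrix_mul_assoc)
  also have "\<dots> = trace (P ** \<rho> ** adjoint_mat P)"
    using assms(1) by (simp add: orth_projector_def trace_mul_sym[of P "P ** \<rho>"])
  finally show ?thesis
    using trace_psd_nonneg[OF psd_conjugate[OF assms(2)]] by simp
qed

lemma matrix_mult_diff_distrib:
  fixes A :: "'n::finite cop"
  shows "A ** (B - C) = A ** B - A ** C" "(B - C) ** A = B ** A - C ** A"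
  by (simp_all add: vec_eq_iff matrix_matrix_mult_def sum_subtractf algebra_simps)

lemma orth_projector_complement:
  assumes "orth_projector P"
  shows "orth_projector (mat 1 - P)"
  using assms
  by (simp add: orth_projector_def linear_diff[OF linear_adjoint_mat] matrix_mult_diff_distrib)

text \<open>The upper bound is the lower bound for the complementary projector
  \<open>mat 1 - P\<close>, since \<open>\<rho>\<close> has trace 1.\<close>

lemma trace_projector_density_bounds:
  assumes "orth_projector P" "density_operator \<rho>"
  shows "0 \<le> Re (trace (P ** \<rho>))" "Re (trace (P ** \<rho>)) \<le> 1"
proof -
  have "psd \<rho>" "trace \<rho> = 1"
    using assms(2) by (auto simp: density_operator_def)
  then show "0 \<le> Re (trace (P ** \<rho>))" "Re (trace (P ** \<rho>)) \<le> 1"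
    using trace_projector_psd_nonneg[OF assms(1)]
      trace_projector_psd_nonneg[OF orth_projector_complement[OF assms(1)]]
    by (fastforce simp: matrix_mult_diff_distrib trace_sub)+
qed

lemma tp_quantum_operation_linear:
  assumes "tp_quantum_operation \<E>"
  shows "linear \<E>"
proof -
  obtain m :: nat and E where "\<And>\<rho>. \<E> \<rho> = (\<Sum>k<m. E k ** \<rho> ** adjoint_mat (E k))"
    using assms by (auto simp: tp_quantum_operation_def)
  then have "\<E> = (\<lambda>\<rho>. \<Sum>k<m. E k ** \<rho> ** adjoint_mat (E k))"
    by blast
  then show ?thesis
    by (simp add: linear_compose_sum linear_matrix_sandwich)
qed

lemma tp_quantum_operation_density:
  assumes "tp_quantum_operation \<E>" "density_operator \<rho>"
  shows "density_operator (\<E> \<rho>)"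
proof -
  obtain m :: nat and E where E: "(\<Sum>k<m. adjoint_mat (E k) ** E k) = mat 1"
    "\<And>\<rho>. \<E> \<rho> = (\<Sum>k<m. E k ** \<rho> ** adjoint_mat (E k))"
    using assms by (auto simp: tp_quantum_operation_def)
  \<comment> \<open>Cyclicity brings \<open>E k\<close> next to its adjoint. The factor
    \<open>mat 1\<close> makes the right side an instance of \<open>linear_matrix_sandwich\<close>,
    so the sum over \<open>k\<close> can move inside and collapse to the identity.\<close>
  have "trace (E k ** \<rho> ** adjoint_mat (E k)) = trace (mat 1 ** (adjoint_mat (E k) ** E k) ** \<rho>)" for k
    by (simp add: matrix_mul_assoc trace_mul_sym[of _ "adjoint_mat (E k)"])
  then have "trace (\<E> \<rho>) = trace (mat 1 ** (\<Sum>k<m. adjoint_mat (E k) ** E k) ** \<rho>)"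
    by (simp only: E(2) linear_sum[OF linear_trace] linear_sum[OF linear_matrix_sandwich])
  also have "\<dots> = trace \<rho>"
    by (simp add: E(1))
  finally show ?thesis
    using assms(2) by (auto simp: density_operator_def E(2) intro!: psd_sum psd_conjugate)
qed

section \<open>States and acceptance functionals along words\<close>

context
  fixes \<Sigma> :: "'a set" and A :: "('a, 'n::finite) mo1gqfa"
  assumes A: "mo1gqfa \<Sigma> A"
begin

lemma linear_fold_q_op:
  assumes "z \<in> lists \<Sigma>"
  shows "linear (fold (q_op A) z)"
  using assms
proof (induction z)
  case Nil
  then show ?case
    by (simp add: id_def linear_ident)
next
  case (Cons a z)
  then have "linear (q_op A a)"
    using A by (auto simp: mo1gqfa_def intro: tp_quantum_operation_linear)
  with Cons show ?case
    by (auto simp: comp_def intro: linear_compose[unfolded comp_def])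
qed

lemma density_fold_q_op:
  assumes "x \<in> lists \<Sigma>"
  shows "density_operator (fold (q_op A) x (q_init A))"
  using assms
proof (induction x rule: rev_induct)
  case Nil
  then show ?case
    using A by (simp add: mo1gqfa_def)
next
  case (snoc a x)
  then show ?case
    using A by (auto simp: mo1gqfa_def intro: tp_quantum_operation_density)
qed

text \<open>Linearity is over the reals, where taking \<open>Re\<close> is linear as well; these are
  the functionals for the packing bound.\<close>

lemma linear_accept:
  assumes "z \<in> lists \<Sigma>"
  shows "linear (\<lambda>X. Re (trace (q_acc A ** fold (q_op A) z X)))"
proof -
  have "linear (\<lambda>X :: 'n cop. q_acc A ** X)"
    using linear_matrix_sandwich[of "q_acc A" "mat 1"] by simp
  from linear_compose[OF linear_compose[OF linear_compose[OF linear_fold_q_op[OF assms] this] linear_trace]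
      bounded_linear.linear[OF bounded_linear_Re]]
  show ?thesis
    by (simp add: comp_def)
qed

lemma acc_prob_bounds:
  assumes "x \<in> lists \<Sigma>"
  shows "0 \<le> acc_prob A x" "acc_prob A x \<le> 1"
  using A trace_projector_density_bounds[OF _ density_fold_q_op[OF assms]]
  by (simp_all add: acc_prob_def mo1gqfa_def)

end

section \<open>Residual languages\<close>

text \<open>The left quotient of \<open>L\<close> by \<open>x\<close>; its distinct values
  correspond to the Myhill-Nerode classes.\<close>

definition residual :: "'a set \<Rightarrow> 'a list set \<Rightarrow> 'a list \<Rightarrow> 'a list set" where
  "residual \<Sigma> L x = {z \<in> lists \<Sigma>. x @ z \<in> L}"

lemma fold_d_trans_state:
  assumes "dfa \<Sigma> M" "x \<in> lists \<Sigma>"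
  shows "fold (d_trans M) x (d_init M) \<in> d_states M"
  using assms(2)
proof (induction x rule: rev_induct)
  case Nil
  then show ?case
    using assms(1) by (simp add: dfa_def)
next
  case (snoc a x)
  then show ?case
    using assms(1) by (auto simp: dfa_def)
qed

text \<open>The residual of a word depends only on the state that the word reaches.\<close>

lemma finite_residuals:
  assumes "dfa \<Sigma> M"
  shows "finite (residual \<Sigma> (dfa_lang \<Sigma> M) ` lists \<Sigma>)"
proof -
  define R where "R q = {z \<in> lists \<Sigma>. fold (d_trans M) z q \<in> d_final M}" for q
  have "residual \<Sigma> (dfa_lang \<Sigma> M) x \<in> R ` d_states M" if "x \<in> lists \<Sigma>" for x
    using fold_d_trans_state[OF assms that] that
    by (intro image_eqI[of _ _ "fold (d_trans M) x (d_init M)"]) (auto simp: residual_def R_def dfa_lang_def)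
  then have "residual \<Sigma> (dfa_lang \<Sigma> M) ` lists \<Sigma> \<subseteq> R ` d_states M"
    by blast
  then show ?thesis
    by (rule finite_subset) (use assms in \<open>simp add: dfa_def\<close>)
qed

text \<open>By the Myhill-Nerode construction the residuals are themselves the states of an
  automaton for \<open>L\<close>, with which \<open>M\<close> is compared.\<close>

lemma minimal_dfa_card_le_residuals:
  assumes "minimal_dfa \<Sigma> M L"
  shows "card (d_states M) \<le> card (residual \<Sigma> L ` lists \<Sigma>)"
proof -
  define Q where "Q = residual \<Sigma> L ` lists \<Sigma>"
  have M: "dfa \<Sigma> M" "dfa_lang \<Sigma> M = L"
    using assms by (auto simp: minimal_dfa_def)
  then have L: "L \<subseteq> lists \<Sigma>" and fin: "finite Q" and "finite \<Sigma>"
    using finite_residuals[OF M(1)] by (auto simp: dfa_lang_def Q_def dfa_def)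
  \<comment> \<open>Competing automata have states in \<open>nat\<close>: \<open>h\<close> numbers
    the residuals and \<open>inv_into Q h\<close> decodes them.\<close>
  obtain h :: "'a list set \<Rightarrow> nat" where h: "inj_on h Q"
    using finite_imp_inj_to_nat_seg[OF fin] by blast
  define N where "N = \<lparr>d_states = h ` Q, d_init = h (residual \<Sigma> L []),
    d_trans = (\<lambda>a k. h {z \<in> lists \<Sigma>. a # z \<in> inv_into Q h k}),
    d_final = h ` {R \<in> Q. [] \<in> R}\<rparr>"
  have step: "d_trans N a (h (residual \<Sigma> L x)) = h (residual \<Sigma> L (x @ [a]))"
    if "a \<in> \<Sigma>" "x \<in> lists \<Sigma>" for a x
  proof -
    have "inv_into Q h (h (residual \<Sigma> L x)) = residual \<Sigma> L x"
      using h that by (simp add: Q_def)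
    moreover have "{z \<in> lists \<Sigma>. a # z \<in> residual \<Sigma> L x} = residual \<Sigma> L (x @ [a])"
      using that by (auto simp: residual_def)
    ultimately show ?thesis
      by (simp add: N_def)
  qed
  have run: "fold (d_trans N) x (d_init N) = h (residual \<Sigma> L x)" if "x \<in> lists \<Sigma>" for x
    using that
  proof (induction x rule: rev_induct)
    case Nil
    then show ?case
      by (simp add: N_def)
  next
    case (snoc a x)
    then show ?case
      by (simp add: step)
  qed
  have "dfa \<Sigma> N"
    unfolding dfa_def
  proof (intro conjI ballI)
    fix a q assume a: "a \<in> \<Sigma>" and "q \<in> d_states N"
    then obtain x where x: "x \<in> lists \<Sigma>" "q = h (residual \<Sigma> L x)"
      by (auto simp: N_def Q_def)
    then have "d_trans N a q = h (residual \<Sigma> L (x @ [a]))"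
      using a step by simp
    moreover have "x @ [a] \<in> lists \<Sigma>"
      using a x by simp
    ultimately show "d_trans N a q \<in> d_states N"
      unfolding N_def Q_def by force
  qed (use \<open>finite \<Sigma>\<close> fin in \<open>auto simp: N_def Q_def\<close>)
  moreover have "h (residual \<Sigma> L x) \<in> d_final N \<longleftrightarrow> x \<in> L" if "x \<in> lists \<Sigma>" for x
  proof -
    have "residual \<Sigma> L x \<in> Q"
      using that by (simp add: Q_def)
    \<comment> \<open>Injectivity of \<open>h\<close> keeps a residual without the empty word from
      sharing the number of an accepting one.\<close>
    then have "h (residual \<Sigma> L x) \<in> d_final N \<longleftrightarrow> [] \<in> residual \<Sigma> L x"
      using h by (auto simp: N_def dest: inj_onD)
    then show ?thesis
      by (simp add: residual_def)
  qed
  then have "dfa_lang \<Sigma> N = {x \<in> lists \<Sigma>. x \<in> L}"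
    unfolding dfa_lang_def using run by (intro Collect_cong conj_cong refl) simp
  then have "dfa_lang \<Sigma> N = L"
    using L by blast
  ultimately have "card (d_states M) \<le> card (d_states N)"
    using assms by (simp add: minimal_dfa_def)
  also have "\<dots> \<le> card Q"
    using fin by (simp add: N_def card_image_le)
  finally show ?thesis
    by (simp add: Q_def)
qed

section \<open>The lower bound\<close>

lemma recognizes_isolated_gap:
  assumes "recognizes_isolated \<Sigma> A L \<delta>" "x \<in> lists \<Sigma>" "y \<in> lists \<Sigma>" "x \<in> L \<longleftrightarrow> y \<notin> L"
  shows "2 * \<delta> \<le> \<bar>acc_prob A x - acc_prob A y\<bar>"
proof -
  have gap: "2 * \<delta> \<le> acc_prob A u - acc_prob A v"
    if uv: "u \<in> lists \<Sigma>" "v \<in> lists \<Sigma>" "u \<in> L" "v \<notin> L" for u v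
  proof -
    \<comment> \<open>The cut-point lies between the two probabilities, at distance at least
      \<open>\<delta>\<close> from each.\<close>
    obtain c where "c < acc_prob A u" "acc_prob A v \<le> c"
      "\<delta> \<le> \<bar>acc_prob A u - c\<bar>" "\<delta> \<le> \<bar>acc_prob A v - c\<bar>"
      using assms(1) uv unfolding recognizes_isolated_def by blast
    then show ?thesis
      by linarith
  qed
  show ?thesis
    using gap[of x y] gap[of y x] assms(2-4) by (cases "x \<in> L") auto
qed

lemma card_residuals_le:
  fixes A :: "('a, 'n::finite) mo1gqfa"
  assumes A: "mo1gqfa \<Sigma> A" and rec: "recognizes_isolated \<Sigma> A L \<delta>" and \<delta>: "0 < \<delta>"
    and fin: "finite (residual \<Sigma> L ` lists \<Sigma>)"
  shows "real (card (residual \<Sigma> L ` lists \<Sigma>)) \<le> (1 + 1 / \<delta>) ^ (2 * CARD('n)\<^sup>2)"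
proof -
  define Q where "Q = residual \<Sigma> L ` lists \<Sigma>"
  \<comment> \<open>A representative word for each residual; its state \<open>p R\<close> is the
    point to be packed.\<close>
  define w where "w = inv_into (lists \<Sigma>) (residual \<Sigma> L)"
  have w: "w R \<in> lists \<Sigma>" "residual \<Sigma> L (w R) = R" if "R \<in> Q" for R
    using that unfolding Q_def w_def by (rule inv_into_into, rule f_inv_into_f)
  define p where "p R = fold (q_op A) (w R) (q_init A)" for R
  define f where "f z X = Re (trace (q_acc A ** fold (q_op A) z X))" for z X
  have f: "f z (p R) = acc_prob A (w R @ z)" for z R
    by (simp add: f_def p_def acc_prob_def)
  have "real (card Q) \<le> (1 + 1 / \<delta>) ^ DIM('n cop)"
  proof (rule card_separated_by_functionals_le[where F = "f ` lists \<Sigma>" and p = p])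
    show "linear g" if "g \<in> f ` lists \<Sigma>" for g
      using that linear_accept[OF A] by (auto simp: f_def[abs_def])
    show "\<bar>g (p R)\<bar> \<le> 1" if "g \<in> f ` lists \<Sigma>" "R \<in> Q" for g R
    proof -
      obtain z where z: "z \<in> lists \<Sigma>" "g = f z"
        using \<open>g \<in> _\<close> by blast
      then have "w R @ z \<in> lists \<Sigma>"
        using w(1)[OF \<open>R \<in> Q\<close>] by simp
      then show ?thesis
        using acc_prob_bounds[OF A] z by (simp add: f abs_le_iff order_trans[of _ 0])
    qed
    show "\<exists>g\<in>f ` lists \<Sigma>. 2 * \<delta> \<le> \<bar>g (p R) - g (p S)\<bar>" if RS: "R \<in> Q" "S \<in> Q" "R \<noteq> S" for R S
    proof -
      have "residual \<Sigma> L (w R) \<noteq> residual \<Sigma> L (w S)"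
        using RS w by simp
      \<comment> \<open>A suffix in exactly one of the two residuals provides the separating
        functional \<open>f z\<close>.\<close>
      then obtain z where z: "z \<in> lists \<Sigma>" "w R @ z \<in> L \<longleftrightarrow> w S @ z \<notin> L"
        by (auto simp: residual_def)
      then have "2 * \<delta> \<le> \<bar>f z (p R) - f z (p S)\<bar>"
        unfolding f using RS w(1) by (intro recognizes_isolated_gap[OF rec]) auto
      with z(1) show ?thesis
        by blast
    qed
  qed (use fin \<delta> in \<open>auto simp: Q_def\<close>)
  \<comment> \<open>The factor 2 in the exponent is the real dimension of the complex
    numbers.\<close>
  then show ?thesis
    by (simp add: Q_def power2_eq_square mult_ac)
qed

theorem theorem10:
  fixes \<Sigma> :: "'a set"
    and L :: "'a list set"
    and M :: "('a, 'q) dfa"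
    and A :: "('a, 'n::finite) mo1gqfa"
    and d n :: nat
    and \<delta> :: real
  assumes "minimal_dfa \<Sigma> M L"
    and "card (d_states M) = d"
    and "mo1gqfa \<Sigma> A"
    and "n = CARD('n)"
    and "0 < \<delta>" and "\<delta> \<le> 1 / 2"
    and "recognizes_isolated \<Sigma> A L \<delta>"
  shows "real n \<ge> (ln (real d) / (2 * ln (2 / \<delta>))) powr (4 / 9)"
proof -
  have M: "dfa \<Sigma> M" "dfa_lang \<Sigma> M = L"
    using assms(1) by (auto simp: minimal_dfa_def)
  have d: "1 \<le> d"
    using M(1) assms(2) by (auto simp: dfa_def Suc_le_eq card_gt_0_iff)
  have n: "1 \<le> real n"
    using assms(4) by (simp add: Suc_le_eq)
  \<comment> \<open>The first inequality amounts to \<open>\<delta> \<le> 1\<close>; the second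
    makes the logarithm in the denominator positive.\<close>
  have \<delta>: "1 + 1 / \<delta> \<le> 2 / \<delta>" "1 < 2 / \<delta>"
    using assms(5,6) by (auto simp: field_simps)
  have "real d \<le> real (card (residual \<Sigma> L ` lists \<Sigma>))"
    using minimal_dfa_card_le_residuals[OF assms(1)] assms(2) by simp
  also have "\<dots> \<le> (1 + 1 / \<delta>) ^ (2 * n\<^sup>2)"
    using card_residuals_le[OF assms(3,7,5)] finite_residuals[OF M(1)] M(2) assms(4) by simp
  also have "\<dots> \<le> (2 / \<delta>) ^ (2 * n\<^sup>2)"
    using \<delta>(1) assms(5) by (intro power_mono) auto
  finally have "ln (real d) \<le> ln ((2 / \<delta>) ^ (2 * n\<^sup>2))"
    using d by simp
  also have "\<dots> = 2 * real n ^ 2 * ln (2 / \<delta>)"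
    using \<delta>(2) by (subst ln_realpow) auto
  finally have "ln (real d) / (2 * ln (2 / \<delta>)) \<le> real n ^ 2"
    using \<delta>(2) by (simp add: pos_divide_le_eq ln_gt_zero mult_ac)
  \<comment> \<open>Monotonicity of \<open>powr\<close> in the base requires a nonnegative
    base.\<close>
  moreover have "0 \<le> ln (real d) / (2 * ln (2 / \<delta>))"
    using d \<delta>(2) by (intro divide_nonneg_nonneg) auto
  ultimately have "(ln (real d) / (2 * ln (2 / \<delta>))) powr (4 / 9) \<le> (real n ^ 2) powr (4 / 9)"
    by (intro powr_mono2) auto
  also have "\<dots> = (real n powr 2) powr (4 / 9)"
    using n by simp
  also have "\<dots> = real n powr (8 / 9)"
    unfolding powr_powr by simp
  \<comment> \<open>Since \<open>n\<close> is at least 1, the exponent \<open>8 / 9\<close> may be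
    raised to 1.\<close>
  also have "\<dots> \<le> real n powr 1"
    using n by (intro powr_mono) auto
  also have "\<dots> = real n"
    using n by simp
  finally show ?thesis .
qed

end
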